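(* Let $r\geq 2$ be an even integer, let $k\geq r$ be an integer, and let $p\geq r$ be a real number. If $G_w$ is a weighted $k$-partite $r$-graph (with at least one edge of nonzero weight), then $$\frac{\lambda^{(p)}(G_w)}{\lambda_{\min}^{(p)}(G_w)}\;\geq\;\frac{\lambda^{(p)}(K_k^r)}{\lambda_{\min}^{(p)}(K_k^r)}.$$ Moreover, if $G$ is a complete regular $k$-partite $r$-graph (with all edge weights equal to $1$), then equality holds, i.e. $\lambda^{(p)}(G)/\lambda_{\min}^{(p)}(G)=\lambda^{(p)}(K_k^r)/\lambda_{\min}^{(p)}(K_k^r)$.
   Context: An $r$-graph $G$ is an $r$-uniform hypergraph with finite vertex set $V(G)=[n]=\{1,\ldots,n\}$ and edge set $E(G)$ consisting of $r$-element subsets of $V(G)$. A weighted $r$-graph $G_w$ is an $r$-graph $G$ together with a function $w:E(G)\to\mathbb{R}$ (weights may be negative); write $w_{i_1,\ldots,i_r}=w(\{i_1,\ldots,i_r\})$. If no $w$ is given, all edges have weight $1$. The polynomial form of $G_w$ is the function $P_{G_w}:\mathbb{R}^n\to\mathbb{R}$, $$P_{G_w}(\mathbf{x}):=r!\sum_{\{i_1,\ldots,i_r\}\in E(G)}w_{i_1,\ldots,i_r}\,x_{i_1}\cdots x_{i_r}.$$ For real $p\geq 1$, let $|\mathbf{x}|_p=(\sum_i|x_i|^p)^{1/p}$ and define $$\lambda^{(p)}(G_w):=\max_{|\mathbf{x}|_p=1}P_{G_w}(\mathbf{x}),\qquad \lambda_{\min}^{(p)}(G_w):=\min_{|\mathbf{x}|_p=1}P_{G_w}(\mathbf{x}),$$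 where $\mathbf{x}$ ranges over real vectors. Standing assumption: $E(G)\neq\varnothing$ and $w$ is not identically zero on $E(G)$; under this assumption $\lambda^{(p)}(G_w)>0$ and $\lambda_{\min}^{(p)}(G_w)<0$. An $r$-graph $G$ is $k$-partite if $V(G)$ can be partitioned into $k$ sets so that each edge contains at most one vertex from each partition set; a weighted $r$-graph is $k$-partite if its underlying $r$-graph is. A complete $k$-partite $r$-graph is one whose vertex set is partitioned into $k$ nonempty sets and whose edges are all $r$-subsets of vertices containing at most one vertex from each partition set; it is regular if every vertex lies in the same number of edges (equivalently here, if all $k$ partition sets have the same size). $K_k^r$ denotes the complete $r$-graph of order $k$ (all $r$-subsets of $[k]$ are edges, each with weight $1$). *)

theory Defs
  imports Complex_Main "HOL-Library.Disjoint_Sets"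
begin

text \<open>
  An \<open>r\<close>-graph is given by its order \<open>n\<close> and its edge set \<open>E\<close>; the vertex set is \<open>{1..n}\<close>.
  Weights are total functions on sets of vertices, of which only the values on \<open>E\<close> are used.
  A vector of \<open>\<real>\<^sup>n\<close> is a function on the naturals, of which only the values on \<open>{1..n}\<close> are used.
\<close>

definition is_rgraph :: "nat \<Rightarrow> nat \<Rightarrow> nat set set \<Rightarrow> bool" where
  "is_rgraph r n E \<longleftrightarrow> (\<forall>e\<in>E. e \<subseteq> {1..n} \<and> card e = r)"

definition poly_form :: "nat \<Rightarrow> nat set set \<Rightarrow> (nat set \<Rightarrow> real) \<Rightarrow> (nat \<Rightarrow> real) \<Rightarrow> real" where
  "poly_form r E w x = fact r * (\<Sum>e\<in>E. w e * (\<Prod>i\<in>e. x i))"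

definition pnorm :: "nat \<Rightarrow> real \<Rightarrow> (nat \<Rightarrow> real) \<Rightarrow> real" where
  "pnorm n p x = (\<Sum>i=1..n. \<bar>x i\<bar> powr p) powr (1 / p)"

text \<open>
  The maximum and the minimum exist for \<open>n \<ge> 1\<close> and \<open>p \<ge> 1\<close>, since the unit sphere of the
  \<open>p\<close>-norm in \<open>\<real>\<^sup>n\<close> is compact and nonempty.
\<close>

definition lambda_max ::
    "nat \<Rightarrow> nat \<Rightarrow> nat set set \<Rightarrow> (nat set \<Rightarrow> real) \<Rightarrow> real \<Rightarrow> real" where
  "lambda_max r n E w p = (GREATEST t. \<exists>x. pnorm n p x = 1 \<and> t = poly_form r E w x)"

definition lambda_min ::
    "nat \<Rightarrow> nat \<Rightarrow> nat set set \<Rightarrow> (nat set \<Rightarrow> real) \<Rightarrow> real \<Rightarrow> real" where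
  "lambda_min r n E w p = (LEAST t. \<exists>x. pnorm n p x = 1 \<and> t = poly_form r E w x)"

definition unit_weight :: "nat set \<Rightarrow> real" where
  "unit_weight e = 1"

text \<open>The classes \<open>V 1, \<dots>, V k\<close> of a partition may be empty here.\<close>

definition vertex_partition :: "nat \<Rightarrow> nat \<Rightarrow> (nat \<Rightarrow> nat set) \<Rightarrow> bool" where
  "vertex_partition k n V \<longleftrightarrow> disjoint_family_on V {1..k} \<and> (\<Union>j\<in>{1..k}. V j) = {1..n}"

definition is_partite :: "nat \<Rightarrow> nat \<Rightarrow> nat set set \<Rightarrow> bool" where
  "is_partite k n E \<longleftrightarrow>
     (\<exists>V. vertex_partition k n V \<and> (\<forall>e\<in>E. \<forall>j\<in>{1..k}. card (e \<inter> V j) \<le> 1))"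

definition is_complete_partite :: "nat \<Rightarrow> nat \<Rightarrow> nat \<Rightarrow> nat set set \<Rightarrow> bool" where
  "is_complete_partite r k n E \<longleftrightarrow>
     (\<exists>V. vertex_partition k n V \<and> (\<forall>j\<in>{1..k}. V j \<noteq> {}) \<and>
        E = {e. e \<subseteq> {1..n} \<and> card e = r \<and> (\<forall>j\<in>{1..k}. card (e \<inter> V j) \<le> 1)})"

definition is_regular :: "nat \<Rightarrow> nat set set \<Rightarrow> bool" where
  "is_regular n E \<longleftrightarrow>
     (\<forall>u\<in>{1..n}. \<forall>v\<in>{1..n}. card {e\<in>E. u \<in> e} = card {e\<in>E. v \<in> e})"

definition complete_rgraph :: "nat \<Rightarrow> nat \<Rightarrow> nat set set" where
  "complete_rgraph r k = {e. e \<subseteq> {1..k} \<and> card e = r}"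

end

theory Submission
  imports Defs "HOL-Analysis.Analysis" "HOL-Combinatorics.Permutations"
begin

text \<open>
  Write \<open>L, m\<close> for the extrema of a partite hypergraph \<open>G\<close> on the unit sphere, \<open>L', m'\<close> for those
  of the complete hypergraph \<open>K\<close> on its \<open>k\<close> classes, and \<open>P, P'\<close> for the two forms. The minima are
  negative, so the inequality \<open>L / m \<ge> L' / m'\<close> says that \<open>m * L' \<le> L * m'\<close>.

  Let \<open>x\<close> be a maximiser for \<open>G\<close> and \<open>y\<close> a minimiser for \<open>K\<close>. For each bijection between the
  classes of \<open>G\<close> and the coordinates of \<open>y\<close>, multiply the coordinates of \<open>x\<close> in a class by the
  corresponding coordinate of \<open>y\<close>. Each of the resulting vectors \<open>z\<close> satisfies
  \<open>P z \<ge> m * |z|^r\<close>. Averaged over all bijections, \<open>P z\<close> becomes the product of \<open>P x = L\<close> and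
  \<open>P' y = m'\<close>, divided by the number \<open>r! (k choose r)\<close> (lemma \<open>sum_permutes_prod\<close>), while the
  mean of \<open>|z|^p\<close> is \<open>1 / k\<close>, so that by concavity of \<open>t powr (r / p)\<close> the mean of \<open>|z|^r\<close> is at
  most \<open>k powr (- r / p)\<close>; this is where \<open>p \<ge> r\<close> enters. Hence
  \<open>m * r! (k choose r) k powr (- r / p) \<le> L * m'\<close> (lemma \<open>lambda_min_partite_le\<close>), and the factor
  of \<open>m\<close> is at most \<open>L'\<close>, being the value of \<open>P'\<close> at the uniform unit vector.

  If \<open>G\<close> is complete and regular, its classes have a common size \<open>t\<close>
  (lemma \<open>regular_imp_equal_classes\<close>), and \<open>P x\<close> is the value of \<open>P'\<close> at the vector of class sums
  of \<open>x\<close>. With \<open>s = t powr (1 - 1 / p)\<close>, spreading a maximiser for \<open>K\<close> evenly over the classes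
  gives \<open>L \<ge> s^r * L'\<close>, and the power mean inequality within classes gives \<open>m \<ge> s^r * m'\<close>. Together
  they give the reverse inequality \<open>L / m \<le> L' / m'\<close>
  (lemma \<open>lambda_ratio_complete_balanced_le\<close>).
\<close>

section \<open>Elementary symmetric polynomials\<close>

definition elem_sym :: "nat \<Rightarrow> 'a set \<Rightarrow> ('a \<Rightarrow> real) \<Rightarrow> real" where
  "elem_sym r A a = (\<Sum>J | J \<subseteq> A \<and> card J = r. \<Prod>j\<in>J. a j)"

lemma elem_sym_cong:
  assumes "\<And>j. j \<in> A \<Longrightarrow> a j = b j"
  shows "elem_sym r A a = elem_sym r A b"
  unfolding elem_sym_def by (intro sum.cong prod.cong refl) (use assms in auto)

lemma elem_sym_const:
  assumes "finite A"
  shows "elem_sym r A (\<lambda>_. a) = real (card A choose r) * a ^ r"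
proof -
  have "elem_sym r A (\<lambda>_. a) = (\<Sum>J | J \<subseteq> A \<and> card J = r. a ^ r)"
    unfolding elem_sym_def by (intro sum.cong refl) auto
  then show ?thesis using n_subsets[OF assms] by simp
qed

lemma elem_sym_pos:
  assumes "finite A" "r \<le> card A" "\<And>j. j \<in> A \<Longrightarrow> a j > 0"
  shows "elem_sym r A a > 0"
  unfolding elem_sym_def
proof (rule sum_pos)
  show "finite {J. J \<subseteq> A \<and> card J = r}" using assms(1) by simp
  show "{J. J \<subseteq> A \<and> card J = r} \<noteq> {}"
    using obtain_subset_with_card_n[OF assms(2)] by blast
  show "0 < prod a J" if "J \<in> {J. J \<subseteq> A \<and> card J = r}" for J
    using that assms(3) by (intro prod_pos) auto
qed

lemma elem_sym_insert:
  assumes "finite A" "j \<notin> A"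
  shows "elem_sym (Suc r) (insert j A) a = elem_sym (Suc r) A a + a j * elem_sym r A a"
proof -
  let ?S = "\<lambda>r. {J. J \<subseteq> A \<and> card J = r}"
  have fin: "finite J" if "J \<subseteq> A" for J using that assms(1) finite_subset by blast
  have split: "{J. J \<subseteq> insert j A \<and> card J = Suc r} = ?S (Suc r) \<union> insert j ` ?S r"
  proof (intro equalityI subsetI)
    fix J assume J: "J \<in> {J. J \<subseteq> insert j A \<and> card J = Suc r}"
    show "J \<in> ?S (Suc r) \<union> insert j ` ?S r"
    proof (cases "j \<in> J")
      case True
      then have "J = insert j (J - {j})" "J - {j} \<in> ?S r" using J by auto
      then show ?thesis by blast
    qed (use J in auto)
  next
    fix J assume "J \<in> ?S (Suc r) \<union> insert j ` ?S r"
    then show "J \<in> {J. J \<subseteq> insert j A \<and> card J = Suc r}"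
      using assms(2) fin by (auto simp: card_insert_if)
  qed
  have inj: "inj_on (insert j) (?S r)"
    using assms(2) by (auto simp: inj_on_def)
  have "(\<Sum>J\<in>insert j ` ?S r. prod a J) = (\<Sum>J\<in>?S r. a j * prod a J)"
    unfolding sum.reindex[OF inj] o_def
    by (intro sum.cong refl prod.insert) (use assms(2) fin in auto)
  moreover have "elem_sym (Suc r) (insert j A) a
      = (\<Sum>J\<in>?S (Suc r). prod a J) + (\<Sum>J\<in>insert j ` ?S r. prod a J)"
    unfolding elem_sym_def split
    by (rule sum.union_disjoint) (use assms in auto)
  ultimately show ?thesis by (simp add: elem_sym_def sum_distrib_left)
qed

lemma elem_sym_permutes:
  assumes "\<sigma> permutes A"
  shows "elem_sym r A (\<lambda>j. a (\<sigma> j)) = elem_sym r A a"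
proof -
  have inj: "inj \<sigma>" using assms by (rule permutes_inj)
  have "bij_betw ((`) \<sigma>) {J. J \<subseteq> A \<and> card J = r} {J. J \<subseteq> A \<and> card J = r}"
  proof (rule bij_betwI[where g = "(`) (inv \<sigma>)"])
    have "\<sigma> ` J \<subseteq> A" if "J \<subseteq> A" for J
      using permutes_image[OF assms] that by blast
    then show "(`) \<sigma> \<in> {J. J \<subseteq> A \<and> card J = r} \<rightarrow> {J. J \<subseteq> A \<and> card J = r}"
      using inj by (auto simp: card_image inj_on_subset)
    have i: "inv \<sigma> permutes A" using assms by (rule permutes_inv)
    have "inv \<sigma> ` J \<subseteq> A" if "J \<subseteq> A" for J
      using permutes_image[OF i] that by blast
    then show "(`) (inv \<sigma>) \<in> {J. J \<subseteq> A \<and> card J = r} \<rightarrow> {J. J \<subseteq> A \<and> card J = r}"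
      using permutes_inj[OF i] by (auto simp: card_image inj_on_subset)
  qed (use assms in \<open>auto simp: image_image permutes_inverses\<close>)
  from sum.reindex_bij_betw[OF this, of "prod a"]
  show ?thesis unfolding elem_sym_def
    using inj by (simp add: prod.reindex inj_on_subset)
qed

lemma exists_permutes_image_eq:
  assumes "finite A" "J \<subseteq> A" "J' \<subseteq> A" "card J = card J'"
  obtains \<tau> where "\<tau> permutes A" "\<tau> ` J = J'"
proof -
  have fin: "finite J" "finite J'" using assms finite_subset by auto
  obtain f where f: "bij_betw f J J'"
    using finite_same_card_bij[OF fin assms(4)] by blast
  have "card (A - J) = card (A - J')" using assms fin by (simp add: card_Diff_subset)
  then obtain g where g: "bij_betw g (A - J) (A - J')"
    using finite_same_card_bij[of "A - J" "A - J'"] assms(1) by blast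
  define \<tau> where "\<tau> i = (if i \<in> J then f i else if i \<in> A then g i else i)" for i
  have "bij_betw \<tau> J J'" using f by (rule bij_betw_cong[THEN iffD1, rotated]) (auto simp: \<tau>_def)
  moreover have "bij_betw \<tau> (A - J) (A - J')"
    using g by (rule bij_betw_cong[THEN iffD1, rotated]) (auto simp: \<tau>_def)
  ultimately have "bij_betw \<tau> (J \<union> (A - J)) (J' \<union> (A - J'))"
    by (rule bij_betw_combine) auto
  then have "bij_betw \<tau> A A" using assms by (simp add: Un_absorb1)
  then have "\<tau> permutes A" by (rule bij_imp_permutes) (use assms in \<open>auto simp: \<tau>_def\<close>)
  with \<open>bij_betw \<tau> J J'\<close> show ?thesis using that by (auto simp: bij_betw_def)
qed

text \<open>
  The left-hand sum does not depend on \<open>J\<close>, because composing with a permutation that carries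
  \<open>J\<close> to \<open>J'\<close> turns one sum into the other. Summing over all \<open>J\<close> therefore multiplies it by the
  number of \<open>J\<close>, while each permutation contributes the whole symmetric polynomial to the total.
\<close>

lemma sum_permutes_prod:
  assumes "finite A" "J \<subseteq> A" "card J = r"
  shows "real (card A choose r) * (\<Sum>\<sigma> | \<sigma> permutes A. \<Prod>j\<in>J. a (\<sigma> j))
           = fact (card A) * elem_sym r A a"
proof -
  define F where "F J = (\<Sum>\<sigma> | \<sigma> permutes A. \<Prod>j\<in>J. a (\<sigma> j))" for J
  let ?S = "{J. J \<subseteq> A \<and> card J = r}"
  have const: "F J' = F J" if J': "J' \<in> ?S" for J'
  proof -
    have "J' \<subseteq> A" "card J = card J'" using J' assms(3) by auto
    then obtain \<tau> where \<tau>: "\<tau> permutes A" "\<tau> ` J = J'"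
      using exists_permutes_image_eq[OF assms(1,2)] by metis
    have "F J' = (\<Sum>\<sigma> | \<sigma> permutes A. \<Prod>j\<in>J. a ((\<sigma> \<circ> \<tau>) j))"
      unfolding F_def \<tau>(2)[symmetric] using permutes_inj[OF \<tau>(1)]
      by (simp add: prod.reindex inj_on_subset)
    also have "\<dots> = F J"
      unfolding F_def by (rule sum_permutations_compose_right[OF \<tau>(1), symmetric])
    finally show ?thesis .
  qed
  have "real (card A choose r) * F J = (\<Sum>J'\<in>?S. F J')"
    using const n_subsets[OF assms(1), of r] by simp
  also have "\<dots> = (\<Sum>\<sigma> | \<sigma> permutes A. elem_sym r A (\<lambda>j. a (\<sigma> j)))"
    unfolding F_def elem_sym_def by (rule sum.swap)
  also have "\<dots> = fact (card A) * elem_sym r A a"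
    using card_permutations[OF refl assms(1)] by (simp add: elem_sym_permutes)
  finally show ?thesis by (simp add: F_def)
qed

text \<open>
  The colour classes of \<open>c\<close> play the role of the parts of a partite hypergraph:
  choosing a transversal edge means choosing the set \<open>J\<close> of classes that it meets, and then one
  vertex in each of them.
\<close>

lemma sum_prod_transversals:
  fixes x :: "'a \<Rightarrow> real"
  assumes "finite X" "finite A" "c ` X \<subseteq> A"
  shows "(\<Sum>e | e \<subseteq> X \<and> card e = r \<and> inj_on c e. \<Prod>i\<in>e. x i)
           = elem_sym r A (\<lambda>j. \<Sum>i | i \<in> X \<and> c i = j. x i)"
proof -
  let ?E = "{e. e \<subseteq> X \<and> card e = r \<and> inj_on c e}"
  let ?S = "{J. J \<subseteq> A \<and> card J = r}"
  let ?V = "\<lambda>j. {i. i \<in> X \<and> c i = j}"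
  have "(\<Sum>e\<in>?E. \<Prod>i\<in>e. x i) = (\<Sum>J\<in>?S. \<Sum>e | e \<in> ?E \<and> c ` e = J. \<Prod>i\<in>e. x i)"
  proof (rule sum.group[symmetric])
    show "image c ` ?E \<subseteq> ?S" using assms(3) by (auto simp: card_image)
  qed (use assms in auto)
  also have "\<dots> = (\<Sum>J\<in>?S. \<Prod>j\<in>J. \<Sum>i\<in>?V j. x i)"
  proof (intro sum.cong refl)
    fix J assume J: "J \<in> ?S"
    then have fJ: "finite J" using assms(2) finite_subset by blast
    have inv: "c (f j) = j" "f j \<in> X" if "f \<in> PiE J ?V" "j \<in> J" for f j
      using that by auto
    have injf: "inj_on f J" if "f \<in> PiE J ?V" for f
      using inv[OF that] by (metis inj_on_inverseI)
    have "bij_betw (\<lambda>f. f ` J) (PiE J ?V) {e. e \<in> ?E \<and> c ` e = J}"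
    proof (rule bij_betwI[where g = "\<lambda>e. restrict (the_inv_into e c) J"])
      show "(\<lambda>f. f ` J) \<in> PiE J ?V \<rightarrow> {e. e \<in> ?E \<and> c ` e = J}"
      proof
        fix f assume f: "f \<in> PiE J ?V"
        have "f ` J \<subseteq> X" using inv[OF f] by auto
        moreover have "card (f ` J) = r" using J injf[OF f] by (simp add: card_image)
        moreover have "inj_on c (f ` J)" using inv[OF f] by (auto simp: inj_on_def)
        moreover have "c ` f ` J = J" using inv[OF f] by (force simp: image_image)
        ultimately show "f ` J \<in> {e. e \<in> ?E \<and> c ` e = J}" by simp
      qed
      show "(\<lambda>e. restrict (the_inv_into e c) J) \<in> {e. e \<in> ?E \<and> c ` e = J} \<rightarrow> PiE J ?V"
      proof (intro funcsetI PiE_I)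
        fix e j assume e: "e \<in> {e. e \<in> ?E \<and> c ` e = J}" and j: "j \<in> J"
        then have "the_inv_into e c j \<in> e" "c (the_inv_into e c j) = j"
          by (auto intro!: the_inv_into_into simp: f_the_inv_into_f)
        then show "restrict (the_inv_into e c) J j \<in> ?V j" using e j by auto
      qed auto
      show "restrict (the_inv_into (f ` J) c) J = f" if f: "f \<in> PiE J ?V" for f
      proof (rule PiE_ext[of _ J "\<lambda>_. UNIV" _])
        fix j assume j: "j \<in> J"
        have "inj_on c (f ` J)" using inv[OF f] by (auto simp: inj_on_def)
        then have "the_inv_into (f ` J) c (c (f j)) = f j"
          using j by (intro the_inv_into_f_f) auto
        then show "restrict (the_inv_into (f ` J) c) J j = f j" using inv[OF f j] j by simp
      qed (use f in \<open>auto simp: PiE_def\<close>)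
      show "restrict (the_inv_into e c) J ` J = e" if "e \<in> {e. e \<in> ?E \<and> c ` e = J}" for e
      proof -
        have "restrict (the_inv_into e c) J ` J = the_inv_into e c ` J" by simp
        also have "\<dots> = the_inv_into e c ` c ` e" using that by simp
        also have "\<dots> = e" by (rule the_inv_into_onto) (use that in simp)
        finally show ?thesis .
      qed
    qed
    from sum.reindex_bij_betw[OF this, of "prod x", symmetric]
    have "(\<Sum>e | e \<in> ?E \<and> c ` e = J. prod x e) = (\<Sum>f\<in>PiE J ?V. prod x (f ` J))" .
    also have "\<dots> = (\<Sum>f\<in>PiE J ?V. \<Prod>j\<in>J. x (f j))"
      by (intro sum.cong refl) (simp add: prod.reindex injf)
    also have "\<dots> = (\<Prod>j\<in>J. \<Sum>i\<in>?V j. x i)"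
      by (rule prod_sum_PiE[symmetric]) (use assms fJ in auto)
    finally show "(\<Sum>e | e \<in> ?E \<and> c ` e = J. prod x e) = (\<Prod>j\<in>J. \<Sum>i\<in>?V j. x i)" .
  qed
  finally show ?thesis by (simp add: elem_sym_def)
qed

section \<open>Concavity of powers\<close>

lemma powr_le_tangent:
  fixes t a :: real
  assumes "t \<ge> 0" "0 < a" "a \<le> 1"
  shows "t powr a \<le> 1 + a * (t - 1)"
  using Youngs_inequality_0[of a "1 - a" t 1] assms
  by (cases "t = 0") (simp_all add: algebra_simps)

text \<open>Jensen's inequality, by summing the tangent line bound at the arithmetic mean.\<close>

lemma sum_powr_le_mean_powr:
  fixes b :: "'a \<Rightarrow> real"
  assumes "finite S" "S \<noteq> {}" "\<And>i. i \<in> S \<Longrightarrow> b i \<ge> 0" "0 < a" "a \<le> 1"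
  shows "(\<Sum>i\<in>S. b i powr a) \<le> card S * ((\<Sum>i\<in>S. b i) / card S) powr a"
proof -
  define M where "M = (\<Sum>i\<in>S. b i) / card S"
  have N: "real (card S) > 0" using assms by (simp add: card_gt_0_iff)
  have M0: "M \<ge> 0" using assms by (auto simp: M_def intro!: divide_nonneg_nonneg sum_nonneg)
  show ?thesis
  proof (cases "M = 0")
    case True
    then have "(\<Sum>i\<in>S. b i) = 0" using N by (simp add: M_def)
    then have "\<forall>i\<in>S. b i = 0" using assms by (simp add: sum_nonneg_eq_0_iff)
    then show ?thesis by simp
  next
    case False
    then have M: "M > 0" using M0 by simp
    have "(\<Sum>i\<in>S. b i powr a) = M powr a * (\<Sum>i\<in>S. (b i / M) powr a)"
      using M assms(3) by (simp add: sum_distrib_left powr_divide)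
    also have "\<dots> \<le> M powr a * (\<Sum>i\<in>S. 1 + a * (b i / M - 1))"
      using M assms by (intro mult_left_mono sum_mono powr_le_tangent) auto
    also have "(\<Sum>i\<in>S. 1 + a * (b i / M - 1)) = card S + a * ((\<Sum>i\<in>S. b i) / M - card S)"
      by (simp add: sum.distrib sum_distrib_left[symmetric] sum_subtractf sum_divide_distrib)
    also have "(\<Sum>i\<in>S. b i) / M = card S" using M N by (simp add: M_def field_simps)
    finally show ?thesis by (simp add: M_def mult.commute)
  qed
qed

section \<open>Extrema of polynomial forms on the unit sphere\<close>

lemma pnorm_nonneg: "pnorm n p x \<ge> 0"
  by (simp add: pnorm_def)

lemma pnorm_power:
  assumes "p > 0" "r > 0"
  shows "pnorm n p x ^ r = (\<Sum>i=1..n. \<bar>x i\<bar> powr p) powr (real r / p)"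
  using assms by (simp add: pnorm_def powr_realpow' [symmetric] powr_powr)

lemma pnorm_eq_1_iff:
  assumes "p > 0"
  shows "pnorm n p x = 1 \<longleftrightarrow> (\<Sum>i=1..n. \<bar>x i\<bar> powr p) = 1"
proof
  assume "pnorm n p x = 1"
  then have "(pnorm n p x) powr p = 1" by simp
  then show "(\<Sum>i=1..n. \<bar>x i\<bar> powr p) = 1"
    using assms by (simp add: pnorm_def powr_powr sum_nonneg)
qed (simp add: pnorm_def)

lemma pnorm_scale:
  assumes "p > 0"
  shows "pnorm n p (\<lambda>i. a * x i) = \<bar>a\<bar> * pnorm n p x"
  using assms
  by (simp add: pnorm_def abs_mult powr_mult sum_distrib_left[symmetric] powr_powr sum_nonneg)

lemma pnorm_eq_0:
  assumes "pnorm n p x = 0" "i \<in> {1..n}"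
  shows "x i = 0"
proof -
  have "(\<Sum>i=1..n. \<bar>x i\<bar> powr p) = 0" using assms(1) by (simp add: pnorm_def)
  then show ?thesis using assms(2) by (simp add: sum_nonneg_eq_0_iff)
qed

lemma finite_rgraph: "is_rgraph r n E \<Longrightarrow> finite E"
  by (rule finite_subset[of _ "Pow {1..n}"]) (auto simp: is_rgraph_def)

lemma poly_form_cong:
  assumes "is_rgraph r n E" "\<And>i. i \<in> {1..n} \<Longrightarrow> x i = y i"
  shows "poly_form r E w x = poly_form r E w y"
proof -
  have "prod x e = prod y e" if "e \<in> E" for e
    using assms that by (intro prod.cong) (auto simp: is_rgraph_def subset_iff)
  then show ?thesis by (simp add: poly_form_def)
qed

lemma poly_form_scale:
  assumes "is_rgraph r n E"
  shows "poly_form r E w (\<lambda>i. a * x i) = a ^ r * poly_form r E w x"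
  using assms
  by (auto simp: poly_form_def is_rgraph_def prod.distrib sum_distrib_left mult_ac intro!: sum.cong)

text \<open>
  Vectors are functions on all naturals, and the unit sphere is not compact among them; it
  becomes a compact subset of a product of intervals once the irrelevant coordinates are fixed
  to be zero, which changes neither the norm nor the form.
\<close>

lemma extrema_attained:
  assumes E: "is_rgraph r n E" and "n \<ge> 1" "p > 0"
  obtains x y where "pnorm n p x = 1" "pnorm n p y = 1"
    "\<And>z. pnorm n p z = 1 \<Longrightarrow> poly_form r E w z \<le> poly_form r E w x"
    "\<And>z. pnorm n p z = 1 \<Longrightarrow> poly_form r E w y \<le> poly_form r E w z"
proof -
  define cut :: "(nat \<Rightarrow> real) \<Rightarrow> nat \<Rightarrow> real" where
    "cut x = (\<lambda>i. if i \<in> {1..n} then x i else 0)" for x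
  define B :: "(nat \<Rightarrow> real) set" where "B = PiE UNIV (\<lambda>i. if i \<in> {1..n} then {-1..1} else {0})"
  define S where "S = B \<inter> {x. pnorm n p x = 1}"
  have coord: "continuous_on UNIV (\<lambda>x::nat \<Rightarrow> real. x i)" for i
    by (rule continuous_on_product_coordinates)
  have "compactin (product_topology (\<lambda>_. euclidean) UNIV) B"
    unfolding B_def by (subst compactin_PiE) auto
  then have "compact B" by (simp add: euclidean_product_topology)
  moreover have "closed {x. pnorm n p x = 1}"
    unfolding pnorm_eq_1_iff[OF \<open>p > 0\<close>] using \<open>p > 0\<close>
    by (intro closed_Collect_eq continuous_intros continuous_on_powr' coord) auto
  ultimately have "compact S" unfolding S_def by (rule compact_Int_closed)
  have norm_cut: "pnorm n p (cut x) = pnorm n p x" for x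
    by (simp add: pnorm_def cut_def)
  have cutS: "cut x \<in> S" if "pnorm n p x = 1" for x
  proof -
    have "\<bar>x i\<bar> \<le> 1" if i: "i \<in> {1..n}" for i
    proof -
      have "\<bar>x i\<bar> powr p \<le> (\<Sum>i=1..n. \<bar>x i\<bar> powr p)"
        using i by (intro member_le_sum) auto
      then have "\<bar>x i\<bar> powr p \<le> 1"
        using \<open>pnorm n p x = 1\<close> \<open>p > 0\<close> by (simp add: pnorm_eq_1_iff)
      then have "\<not> 1 powr p < \<bar>x i\<bar> powr p" by simp
      then have "\<not> 1 < \<bar>x i\<bar>" using powr_less_mono2[OF \<open>p > 0\<close>, of 1 "\<bar>x i\<bar>"] by fastforce
      then show ?thesis by simp
    qed
    then have "cut x \<in> B" by (auto simp: B_def cut_def abs_le_iff)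
    then show ?thesis using that by (simp add: S_def norm_cut)
  qed
  have "pnorm n p (\<lambda>i. if i = 1 then 1 else 0) = 1"
    using \<open>n \<ge> 1\<close> \<open>p > 0\<close> by (simp add: pnorm_eq_1_iff if_distrib[of "\<lambda>t. t powr p"] if_distrib[of abs] cong: if_cong)
  then have "S \<noteq> {}" using cutS by blast
  have cont: "continuous_on S (poly_form r E w)"
    unfolding poly_form_def
    by (intro continuous_intros continuous_on_subset[OF coord]) auto
  obtain x where x: "x \<in> S" "\<And>z. z \<in> S \<Longrightarrow> poly_form r E w z \<le> poly_form r E w x"
    using continuous_attains_sup[OF \<open>compact S\<close> \<open>S \<noteq> {}\<close> cont] by blast
  obtain y where y: "y \<in> S" "\<And>z. z \<in> S \<Longrightarrow> poly_form r E w y \<le> poly_form r E w z"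
    using continuous_attains_inf[OF \<open>compact S\<close> \<open>S \<noteq> {}\<close> cont] by blast
  have P_cut: "poly_form r E w (cut z) = poly_form r E w z" for z
    by (rule poly_form_cong[OF E]) (simp add: cut_def)
  show ?thesis
  proof (rule that[of x y])
    fix z assume "pnorm n p z = 1"
    then show "poly_form r E w z \<le> poly_form r E w x" "poly_form r E w y \<le> poly_form r E w z"
      using x(2) y(2) cutS[of z] P_cut[of z] by metis+
  qed (use x y in \<open>auto simp: S_def\<close>)
qed

lemma lambda_max_attained:
  assumes "is_rgraph r n E" "n \<ge> 1" "p > 0"
  obtains x where "pnorm n p x = 1" "lambda_max r n E w p = poly_form r E w x"
    "\<And>z. pnorm n p z = 1 \<Longrightarrow> poly_form r E w z \<le> lambda_max r n E w p"
proof -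
  obtain x y where *: "pnorm n p x = 1"
    "\<And>z. pnorm n p z = 1 \<Longrightarrow> poly_form r E w z \<le> poly_form r E w x"
    using extrema_attained[OF assms] by metis
  have "lambda_max r n E w p = poly_form r E w x"
    unfolding lambda_max_def by (rule Greatest_equality) (use * in auto)
  with * that show ?thesis by metis
qed

lemma lambda_min_attained:
  assumes "is_rgraph r n E" "n \<ge> 1" "p > 0"
  obtains x where "pnorm n p x = 1" "lambda_min r n E w p = poly_form r E w x"
    "\<And>z. pnorm n p z = 1 \<Longrightarrow> lambda_min r n E w p \<le> poly_form r E w z"
proof -
  obtain x y where *: "pnorm n p y = 1"
    "\<And>z. pnorm n p z = 1 \<Longrightarrow> poly_form r E w y \<le> poly_form r E w z"
    using extrema_attained[OF assms] by metis
  have "lambda_min r n E w p = poly_form r E w y"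
    unfolding lambda_min_def by (rule Least_equality) (use * in auto)
  with * that show ?thesis by metis
qed

lemma poly_form_bounds:
  assumes E: "is_rgraph r n E" and "n \<ge> 1" "p > 0" "r > 0"
  shows "poly_form r E w x \<le> lambda_max r n E w p * pnorm n p x ^ r"
    and "lambda_min r n E w p * pnorm n p x ^ r \<le> poly_form r E w x"
proof -
  let ?N = "pnorm n p x"
  have "poly_form r E w x \<le> lambda_max r n E w p * ?N ^ r \<and>
        lambda_min r n E w p * ?N ^ r \<le> poly_form r E w x"
  proof (cases "?N = 0")
    case True
    have "poly_form r E w x = poly_form r E w (\<lambda>i. 0 * x i)"
      by (rule poly_form_cong[OF E]) (simp add: pnorm_eq_0[OF True])
    also have "\<dots> = 0" using \<open>r > 0\<close> by (subst poly_form_scale[OF E]) simp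
    finally show ?thesis using True \<open>r > 0\<close> by (simp add: zero_power)
  next
    case False
    then have N: "?N > 0" using pnorm_nonneg[of n p x] by simp
    define z where "z i = (1 / ?N) * x i" for i
    have "pnorm n p z = 1"
      unfolding z_def using N by (subst pnorm_scale[OF \<open>p > 0\<close>]) simp
    then have "poly_form r E w z \<le> lambda_max r n E w p" "lambda_min r n E w p \<le> poly_form r E w z"
      using lambda_max_attained[OF assms(1-3)] lambda_min_attained[OF assms(1-3)] by metis+
    moreover have "poly_form r E w z = poly_form r E w x / ?N ^ r"
      unfolding z_def by (subst poly_form_scale[OF E]) (simp add: power_divide)
    ultimately show ?thesis using N by (simp add: field_simps)
  qed
  then show "poly_form r E w x \<le> lambda_max r n E w p * pnorm n p x ^ r"
    and "lambda_min r n E w p * pnorm n p x ^ r \<le> poly_form r E w x" by auto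
qed

text \<open>
  The indicator vector of an edge \<open>e\<close> isolates the single monomial \<open>e\<close>, and flipping the sign
  of one coordinate in \<open>e\<close> flips the sign of its value; so the form takes both signs.
\<close>

lemma lambda_signs:
  assumes E: "is_rgraph r n E" and "e \<in> E" "w e \<noteq> 0" "p > 0" "r > 0"
  shows "lambda_max r n E w p > 0" "lambda_min r n E w p < 0"
proof -
  have e: "e \<subseteq> {1..n}" "card e = r" "finite e"
    using E \<open>e \<in> E\<close> by (auto simp: is_rgraph_def intro: finite_subset)
  then obtain v where v: "v \<in> e" using \<open>r > 0\<close> by fastforce
  then have n: "n \<ge> 1" using e by auto
  define x where "x s i = (if i \<in> e then if i = v then s else 1 else 0)" for s :: real and i :: nat
  have at_x: "poly_form r E w (x s) = fact r * w e * s" for s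
  proof -
    have "prod (x s) e' = (if e' = e then s else 0)" if "e' \<in> E" for e'
    proof (cases "e' = e")
      case True
      have "prod (x s) e = (\<Prod>i\<in>e. if i = v then s else 1)"
        by (intro prod.cong) (auto simp: x_def)
      then show ?thesis using True e v by simp
    next
      case False
      have e': "finite e'" "card e' = r"
        using E \<open>e' \<in> E\<close> by (auto simp: is_rgraph_def intro: finite_subset)
      then have "\<not> e' \<subseteq> e" using False e card_subset_eq by metis
      then obtain i where "i \<in> e'" "i \<notin> e" by blast
      then have "prod (x s) e' = 0" using e' by (auto simp: x_def)
      then show ?thesis using False by simp
    qed
    then have "poly_form r E w (x s) = fact r * (\<Sum>e'\<in>E. if e' = e then w e * s else 0)"
      unfolding poly_form_def by (intro arg_cong2[where f = "(*)"] sum.cong refl) auto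
    then show ?thesis using finite_rgraph[OF E] \<open>e \<in> E\<close> by simp
  qed
  have "0 < poly_form r E w (x (w e))" using \<open>w e \<noteq> 0\<close>
    by (simp add: at_x power2_eq_square[symmetric] mult.assoc)
  also have "\<dots> \<le> lambda_max r n E w p * pnorm n p (x (w e)) ^ r"
    by (rule poly_form_bounds(1)[OF E n \<open>p > 0\<close> \<open>r > 0\<close>])
  finally show "lambda_max r n E w p > 0"
    using pnorm_nonneg by (simp add: zero_less_mult_iff) (metis not_less zero_le_power)
  have "lambda_min r n E w p * pnorm n p (x (- w e)) ^ r \<le> poly_form r E w (x (- w e))"
    by (rule poly_form_bounds(2)[OF E n \<open>p > 0\<close> \<open>r > 0\<close>])
  also have "\<dots> < 0" using \<open>w e \<noteq> 0\<close>
    by (simp add: at_x power2_eq_square[symmetric] mult.assoc)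
  finally show "lambda_min r n E w p < 0"
    using pnorm_nonneg by (simp add: mult_less_0_iff) (metis not_less zero_le_power)
qed

section \<open>Complete and partite hypergraphs\<close>

lemma is_rgraph_complete: "is_rgraph r k (complete_rgraph r k)"
  by (auto simp: is_rgraph_def complete_rgraph_def)

lemma complete_rgraph_nonempty: "r \<le> k \<Longrightarrow> {1..r} \<in> complete_rgraph r k"
  by (auto simp: complete_rgraph_def)

lemma poly_form_complete:
  "poly_form r (complete_rgraph r k) unit_weight y = fact r * elem_sym r {1..k} y"
  by (simp add: poly_form_def complete_rgraph_def unit_weight_def elem_sym_def)

text \<open>
  The left-hand side is the value of the form at the uniform unit vector.
\<close>

lemma lambda_max_complete_ge:
  assumes "k \<ge> 1" "p > 0" "r > 0"
  shows "fact r * real (k choose r) * (1 / real k) powr (real r / p)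
           \<le> lambda_max r k (complete_rgraph r k) unit_weight p"
proof -
  define u :: "nat \<Rightarrow> real" where "u = (\<lambda>_. 1)"
  have N: "pnorm k p u ^ r = real k powr (real r / p)"
    using assms by (subst pnorm_power) (simp_all add: u_def)
  have "fact r * real (k choose r) = poly_form r (complete_rgraph r k) unit_weight u"
    unfolding poly_form_complete u_def by (subst elem_sym_const) auto
  also have "\<dots> \<le> lambda_max r k (complete_rgraph r k) unit_weight p * real k powr (real r / p)"
    using poly_form_bounds(1)[OF is_rgraph_complete assms(1-3)] N by metis
  finally show ?thesis using assms by (simp add: powr_divide field_simps)
qed

text \<open>
  Sending each vertex to its class turns the condition on the edges into injectivity, which lets
  products over an edge be rewritten as products over the set of classes that it meets.
\<close>

lemma vertex_partition_colouring:
  assumes "vertex_partition k n V"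
  obtains c where "c ` {1..n} \<subseteq> {1..k}" "\<forall>j\<in>{1..k}. V j = {i. i \<in> {1..n} \<and> c i = j}"
    "\<forall>e\<subseteq>{1..n}. (\<forall>j\<in>{1..k}. card (e \<inter> V j) \<le> 1) \<longleftrightarrow> inj_on c e"
proof -
  have disj: "\<And>i j. i \<in> {1..k} \<Longrightarrow> j \<in> {1..k} \<Longrightarrow> i \<noteq> j \<Longrightarrow> V i \<inter> V j = {}"
    and cover: "(\<Union>j\<in>{1..k}. V j) = {1..n}"
    using assms by (auto simp: vertex_partition_def disjoint_family_on_def)
  have "\<forall>i\<in>{1..n}. \<exists>j. j \<in> {1..k} \<and> i \<in> V j" using cover by blast
  then obtain c where c: "\<And>i. i \<in> {1..n} \<Longrightarrow> c i \<in> {1..k} \<and> i \<in> V (c i)" by metis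
  have V: "V j = {i. i \<in> {1..n} \<and> c i = j}" if "j \<in> {1..k}" for j
    using that c cover disj by blast
  have "(\<forall>j\<in>{1..k}. card (e \<inter> V j) \<le> 1) \<longleftrightarrow> inj_on c e" if e: "e \<subseteq> {1..n}" for e
  proof -
    have fin: "finite (e \<inter> V j)" for j using e finite_subset by blast
    have "(\<forall>j\<in>{1..k}. card (e \<inter> V j) \<le> 1)
        \<longleftrightarrow> (\<forall>j\<in>{1..k}. \<forall>u\<in>e \<inter> V j. \<forall>v\<in>e \<inter> V j. u = v)"
      using card_le_Suc0_iff_eq[OF fin] by simp
    also have "\<dots> \<longleftrightarrow> inj_on c e"
    proof
      assume *: "\<forall>j\<in>{1..k}. \<forall>u\<in>e \<inter> V j. \<forall>v\<in>e \<inter> V j. u = v"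
      show "inj_on c e"
      proof (rule inj_onI)
        fix u v assume "u \<in> e" "v \<in> e" "c u = c v"
        then have "c u \<in> {1..k}" "u \<in> e \<inter> V (c u)" "v \<in> e \<inter> V (c u)"
          using c[of u] c[of v] e by auto
        then show "u = v" using * by blast
      qed
    next
      assume "inj_on c e"
      then show "\<forall>j\<in>{1..k}. \<forall>u\<in>e \<inter> V j. \<forall>v\<in>e \<inter> V j. u = v"
        using V by (auto dest: inj_onD)
    qed
    finally show ?thesis .
  qed
  with c V show ?thesis by (intro that[of c]) auto
qed

section \<open>The inequality for partite hypergraphs\<close>

text \<open>
  For a permutation \<open>\<sigma>\<close> of the classes, let
  \<open>z \<sigma> i = y (\<sigma> (c i)) * x i\<close>. An edge meets its \<open>r\<close> classes once each, so averaging the form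
  at \<open>z \<sigma>\<close> over all \<open>\<sigma>\<close> multiplies every monomial of the form at \<open>x\<close> by the same number, the
  normalised symmetric polynomial of \<open>y\<close>. On the other hand the average of the \<open>p\<close>-th power of
  the norm of \<open>z \<sigma>\<close> is \<open>1 / k\<close>, and \<open>r / p \<le> 1\<close> lets Jensen's inequality bound the average of
  its \<open>r\<close>-th power.
\<close>

lemma lambda_min_partite_le:
  assumes E: "is_rgraph r n E"
    and c: "c ` {1..n} \<subseteq> {1..k}" and inj: "\<And>e. e \<in> E \<Longrightarrow> inj_on c e"
    and "0 < r" "r \<le> k" "real r \<le> p" "n \<ge> 1"
    and neg: "lambda_min r n E w p \<le> 0"
    and x: "pnorm n p x = 1" and y: "pnorm k p y = 1"
  shows "lambda_min r n E w p * (fact r * real (k choose r) * (1 / real k) powr (real r / p))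
           \<le> poly_form r E w x * poly_form r (complete_rgraph r k) unit_weight y"
proof -
  define m where "m = lambda_min r n E w p"
  define S where "S = {\<sigma>. \<sigma> permutes {1..k}}"
  define z where "z \<sigma> i = y (\<sigma> (c i)) * x i" for \<sigma> :: "nat \<Rightarrow> nat" and i
  define N where "N \<sigma> = (\<Sum>i=1..n. \<bar>z \<sigma> i\<bar> powr p)" for \<sigma>
  define C where "C = real (k choose r)"
  define K where "K = elem_sym r {1..k} y"
  define a where "a = real r / p"
  have k: "k \<ge> 1" and p: "p > 0" using \<open>0 < r\<close> \<open>r \<le> k\<close> \<open>real r \<le> p\<close> by linarith+
  have a: "0 < a" "a \<le> 1" using p \<open>0 < r\<close> \<open>real r \<le> p\<close> by (auto simp: a_def)
  have C: "C > 0" using \<open>r \<le> k\<close> by (simp add: C_def)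
  have S: "finite S" "card S = fact k"
    using card_permutations[of "{1..k}" k] finite_permutations[of "{1..k}"]
    by (simp_all add: S_def)
  have "id \<in> S" by (simp add: S_def permutes_id)
  then have "S \<noteq> {}" by blast
  have forms: "C * (\<Sum>\<sigma>\<in>S. poly_form r E w (z \<sigma>)) = fact k * K * poly_form r E w x"
  proof -
    have edge: "C * (\<Sum>\<sigma>\<in>S. prod (z \<sigma>) e) = fact k * K * prod x e" if "e \<in> E" for e
    proof -
      have e: "e \<subseteq> {1..n}" "card e = r" using E that by (auto simp: is_rgraph_def)
      have "(\<Sum>\<sigma>\<in>S. prod (z \<sigma>) e) = prod x e * (\<Sum>\<sigma>\<in>S. \<Prod>j\<in>c ` e. y (\<sigma> j))"
        by (simp add: z_def prod.distrib prod.reindex[OF inj[OF that]] sum_distrib_left mult.commute)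
      moreover have "C * (\<Sum>\<sigma>\<in>S. \<Prod>j\<in>c ` e. y (\<sigma> j)) = fact k * K"
        using sum_permutes_prod[of "{1..k}" "c ` e" r y] c e card_image[OF inj[OF that]]
        by (auto simp: C_def S_def K_def)
      ultimately show ?thesis by (simp add: mult_ac)
    qed
    have "C * (\<Sum>\<sigma>\<in>S. poly_form r E w (z \<sigma>))
        = fact r * (\<Sum>e\<in>E. w e * (C * (\<Sum>\<sigma>\<in>S. prod (z \<sigma>) e)))"
      unfolding poly_form_def sum_distrib_left
      by (subst sum.swap) (simp add: mult_ac)
    also have "\<dots> = fact r * (\<Sum>e\<in>E. w e * (fact k * K * prod x e))"
      using edge by simp
    finally show ?thesis by (simp add: poly_form_def sum_distrib_left mult_ac)
  qed
  have norms: "(\<Sum>\<sigma>\<in>S. N \<sigma>) = fact k / k"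
  proof -
    have per_class: "k * (\<Sum>\<sigma>\<in>S. \<bar>y (\<sigma> j)\<bar> powr p) = fact k" if "j \<in> {1..k}" for j
    proof -
      have "elem_sym 1 {1..k} (\<lambda>j. \<bar>y j\<bar> powr p) = (\<Sum>j=1..k. \<bar>y j\<bar> powr p)"
      proof -
        have "{J. J \<subseteq> {1..k} \<and> card J = 1} = (\<lambda>j. {j}) ` {1..k}"
          by (auto simp: card_1_singleton_iff)
        then show ?thesis unfolding elem_sym_def by (simp add: sum.reindex)
      qed
      also have "\<dots> = 1" using y p by (simp add: pnorm_eq_1_iff)
      finally show ?thesis
        using sum_permutes_prod[of "{1..k}" "{j}" 1 "\<lambda>j. \<bar>y j\<bar> powr p"] that
        by (simp add: S_def)
    qed
    have "(\<Sum>\<sigma>\<in>S. N \<sigma>) = (\<Sum>i=1..n. \<bar>x i\<bar> powr p * (\<Sum>\<sigma>\<in>S. \<bar>y (\<sigma> (c i))\<bar> powr p))"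
      unfolding N_def z_def
      by (subst sum.swap) (simp add: abs_mult powr_mult sum_distrib_left mult_ac)
    also have "\<dots> = (\<Sum>i=1..n. \<bar>x i\<bar> powr p * (fact k / k))"
    proof (intro sum.cong refl)
      fix i assume "i \<in> {1..n}"
      then have "c i \<in> {1..k}" using c by blast
      from per_class[OF this] k
      show "\<bar>x i\<bar> powr p * (\<Sum>\<sigma>\<in>S. \<bar>y (\<sigma> (c i))\<bar> powr p) = \<bar>x i\<bar> powr p * (fact k / k)"
        by (simp add: field_simps)
    qed
    also have "\<dots> = (\<Sum>i=1..n. \<bar>x i\<bar> powr p) * (fact k / k)" by (rule sum_distrib_right[symmetric])
    also have "\<dots> = fact k / k" using x p by (simp add: pnorm_eq_1_iff)
    finally show ?thesis .
  qed
  have "(\<Sum>\<sigma>\<in>S. N \<sigma> powr a) \<le> card S * ((\<Sum>\<sigma>\<in>S. N \<sigma>) / card S) powr a"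
    by (rule sum_powr_le_mean_powr) (use S \<open>S \<noteq> {}\<close> a in \<open>auto simp: N_def sum_nonneg\<close>)
  then have jensen: "(\<Sum>\<sigma>\<in>S. N \<sigma> powr a) \<le> fact k * (1 / k) powr a"
    by (simp add: norms S)
  have "m * (fact k * (1 / k) powr a) \<le> m * (\<Sum>\<sigma>\<in>S. N \<sigma> powr a)"
    using jensen neg by (simp add: m_def mult_left_mono_neg)
  also have "\<dots> \<le> (\<Sum>\<sigma>\<in>S. poly_form r E w (z \<sigma>))"
    unfolding sum_distrib_left
  proof (rule sum_mono)
    fix \<sigma>
    show "m * N \<sigma> powr a \<le> poly_form r E w (z \<sigma>)"
      using poly_form_bounds(2)[OF E \<open>n \<ge> 1\<close> p \<open>0 < r\<close>, of w "z \<sigma>"] pnorm_power[OF p \<open>0 < r\<close>]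
      by (simp add: m_def N_def a_def)
  qed
  finally have "C * (m * (fact k * (1 / k) powr a)) \<le> fact k * K * poly_form r E w x"
    using C forms by (metis mult_left_mono less_imp_le)
  then have "fact k * (m * (C * (1 / k) powr a)) \<le> fact k * (poly_form r E w x * K)"
    by (simp add: mult_ac)
  then have "m * (C * (1 / k) powr a) \<le> poly_form r E w x * K" by simp
  then have "fact r * (m * (C * (1 / k) powr a)) \<le> fact r * (poly_form r E w x * K)" by simp
  then show ?thesis
    unfolding poly_form_complete m_def C_def K_def a_def by (simp add: mult_ac)
qed

lemma ratio_ge_iff:
  fixes L m L' m' :: real
  assumes "m < 0" "m' < 0"
  shows "L / m \<ge> L' / m' \<longleftrightarrow> m * L' \<le> L * m'"
  using assms by (simp add: field_simps)

lemma lambda_ratio_partite_ge: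
  assumes E: "is_rgraph r n E" and c: "c ` {1..n} \<subseteq> {1..k}" "\<And>e. e \<in> E \<Longrightarrow> inj_on c e"
    and e: "e \<in> E" "w e \<noteq> 0" and r: "0 < r" "r \<le> k" "real r \<le> p"
  shows "lambda_max r n E w p / lambda_min r n E w p
           \<ge> lambda_max r k (complete_rgraph r k) unit_weight p
               / lambda_min r k (complete_rgraph r k) unit_weight p"
proof -
  have p: "p > 0" and k: "k \<ge> 1" using r by linarith+
  have "e \<subseteq> {1..n}" "e \<noteq> {}" using E e r by (auto simp: is_rgraph_def)
  then have n: "n \<ge> 1" by auto
  let ?K = "complete_rgraph r k"
  have neg: "lambda_min r n E w p < 0" using lambda_signs[where w = w, OF E e p] r by simp
  have negK: "lambda_min r k ?K unit_weight p < 0"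
    using lambda_signs[OF is_rgraph_complete complete_rgraph_nonempty[OF \<open>r \<le> k\<close>], of unit_weight p]
      p r by (simp add: unit_weight_def)
  obtain x where x: "pnorm n p x = 1" "lambda_max r n E w p = poly_form r E w x"
    using lambda_max_attained[OF E n p] by metis
  obtain y where y: "pnorm k p y = 1" "lambda_min r k ?K unit_weight p = poly_form r ?K unit_weight y"
    using lambda_min_attained[OF is_rgraph_complete k p] by metis
  have "lambda_min r n E w p * lambda_max r k ?K unit_weight p
      \<le> lambda_min r n E w p * (fact r * real (k choose r) * (1 / real k) powr (real r / p))"
    using lambda_max_complete_ge[OF k p \<open>0 < r\<close>] neg by (simp add: mult_left_mono_neg)
  also have "\<dots> \<le> lambda_max r n E w p * lambda_min r k ?K unit_weight p"
    using lambda_min_partite_le[OF E c r n _ x(1) y(1)] neg x(2) y(2) by simp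
  finally show ?thesis using ratio_ge_iff[OF neg negK] by simp
qed

section \<open>Equality for complete regular partite hypergraphs\<close>

lemma card_transversals:
  assumes "finite X" "finite A" "c ` X \<subseteq> A"
  shows "real (card {e. e \<subseteq> X \<and> card e = r \<and> inj_on c e})
           = elem_sym r A (\<lambda>j. real (card {i. i \<in> X \<and> c i = j}))"
  using sum_prod_transversals[OF assms, where x = "\<lambda>_. 1" and r = r] by simp

text \<open>
  Equal degrees mean that deleting \<open>u\<close> and deleting \<open>v\<close> leave equally many transversals. As a
  polynomial in the two class sizes \<open>a\<close> and \<open>b\<close> of \<open>u\<close> and \<open>v\<close>, the number of transversals is
  \<open>\<alpha> + \<beta> (a + b) + \<gamma> a b\<close>, so \<open>\<gamma> (a - 1) b = \<gamma> a (b - 1)\<close>, where \<open>\<gamma>\<close> is the number of ways to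
  choose the other \<open>r - 2\<close> vertices in the other classes; there is at least one.
\<close>

lemma regular_imp_equal_classes:
  assumes A: "finite A" "r \<ge> 2" "r \<le> card A"
    and c: "c ` {1..n} \<subseteq> A"
    and nonempty: "\<And>j. j \<in> A \<Longrightarrow> {i. i \<in> {1..n} \<and> c i = j} \<noteq> {}"
    and reg: "is_regular n {e. e \<subseteq> {1..n} \<and> card e = r \<and> inj_on c e}"
    and j: "j \<in> A" and l: "l \<in> A"
  shows "card {i. i \<in> {1..n} \<and> c i = j} = card {i. i \<in> {1..n} \<and> c i = l}"
proof (cases "j = l")
  case False
  let ?E = "{e. e \<subseteq> {1..n} \<and> card e = r \<and> inj_on c e}"
  define size where "size X i = real (card {v. v \<in> X \<and> c v = i})" for X i
  obtain u v where u: "u \<in> {1..n}" "c u = j" and v: "v \<in> {1..n}" "c v = l"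
    using nonempty[OF j] nonempty[OF l] by blast
  \<comment> \<open>Expanding the symmetric polynomial in the coordinates \<open>j\<close> and \<open>l\<close> leaves polynomials over \<open>B\<close>.\<close>
  define B where "B = A - {j, l}"
  have B: "finite B" "j \<notin> insert l B" "l \<notin> B" "A = insert j (insert l B)"
    using A j l False by (auto simp: B_def)
  have cardB: "r - 2 \<le> card B" using A j l False by (simp add: B_def card_Diff_subset)
  obtain q where q: "r = Suc (Suc q)" using A(2) by (metis Suc_le_D numeral_2_eq_2 Suc_le_mono)
  have degree: "card {e\<in>?E. u \<in> e} = card {e\<in>?E. v \<in> e}" using reg u(1) v(1) unfolding is_regular_def by blast
  have split: "card ?E = card {e\<in>?E. t \<in> e} + card {e\<in>?E. t \<notin> e}" for t
    by (subst card_Un_disjoint[symmetric]) (auto intro!: arg_cong[where f = card])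
  have avoiding: "card {e\<in>?E. u \<notin> e} = card {e\<in>?E. v \<notin> e}"
    using degree split[of u] split[of v] by linarith
  have count: "real (card {e\<in>?E. t \<notin> e}) = elem_sym r A (size ({1..n} - {t}))" for t
  proof -
    have "{e\<in>?E. t \<notin> e} = {e. e \<subseteq> {1..n} - {t} \<and> card e = r \<and> inj_on c e}" by auto
    then show ?thesis
      using card_transversals[OF _ A(1), of "{1..n} - {t}" c r] c by (simp add: size_def [abs_def] image_subset_iff)
  qed
  have expand: "elem_sym r A a
      = elem_sym r B a + (a j + a l) * elem_sym (Suc q) B a + a j * a l * elem_sym q B a" for a
    unfolding q B(4) using B by (simp add: elem_sym_insert algebra_simps)
  have del: "size ({1..n} - {t}) i = size {1..n} i - (if c t = i then 1 else 0)"
    if t: "t \<in> {1..n}" for t i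
  proof (cases "c t = i")
    case True
    have "{v. v \<in> {1..n} - {t} \<and> c v = i} = {v. v \<in> {1..n} \<and> c v = i} - {t}" by auto
    moreover have "card {v. v \<in> {1..n} \<and> c v = i} > 0" using t True by (auto simp: card_gt_0_iff)
    ultimately show ?thesis using t True by (simp add: size_def)
  next
    case False
    then have "{v. v \<in> {1..n} - {t} \<and> c v = i} = {v. v \<in> {1..n} \<and> c v = i}" by auto
    then show ?thesis using False by (simp add: size_def)
  qed
  have rest: "elem_sym s B (size ({1..n} - {t})) = elem_sym s B (size {1..n})"
    if "t \<in> {u, v}" for s t
    by (rule elem_sym_cong) (use that u v B del in auto)
  have "elem_sym r A (size ({1..n} - {u})) = elem_sym r A (size ({1..n} - {v}))"
    using count[of u] count[of v] unfolding avoiding by (rule trans[OF sym])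
  then have "(size {1..n} j - 1 + size {1..n} l) * elem_sym (Suc q) B (size {1..n})
        + (size {1..n} j - 1) * size {1..n} l * elem_sym q B (size {1..n})
      = (size {1..n} j + (size {1..n} l - 1)) * elem_sym (Suc q) B (size {1..n})
        + size {1..n} j * (size {1..n} l - 1) * elem_sym q B (size {1..n})"
    using u v False by (simp add: expand rest del del: One_nat_def)
  then have "(size {1..n} j - 1) * size {1..n} l * elem_sym q B (size {1..n})
      = size {1..n} j * (size {1..n} l - 1) * elem_sym q B (size {1..n})"
    by (simp add: algebra_simps)
  moreover have "elem_sym q B (size {1..n}) > 0"
  proof (rule elem_sym_pos)
    show "size {1..n} i > 0" if "i \<in> B" for i
      using nonempty[of i] that by (auto simp: size_def card_gt_0_iff B_def)
  qed (use B cardB q in auto)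
  ultimately have "(size {1..n} j - 1) * size {1..n} l = size {1..n} j * (size {1..n} l - 1)" by simp
  then have "size {1..n} j = size {1..n} l" by (simp add: algebra_simps)
  then show ?thesis by (simp add: size_def)
qed simp

text \<open>
  Summing the coordinates over each class turns the form of the complete partite hypergraph into
  that of the complete hypergraph on the classes. On vectors that are constant on each class this
  scales the \<open>p\<close>-norm by \<open>s = t powr (1 - 1 / p)\<close> exactly, and on others by at most \<open>s\<close>, by the
  power mean inequality. So the maximum is at least, and the absolute value of the minimum at
  most, \<open>s ^ r\<close> times its counterpart for the complete hypergraph.
\<close>

lemma lambda_ratio_complete_balanced_le:
  assumes c: "c ` {1..n} \<subseteq> {1..k}" and "t \<ge> 1"
    and size: "\<And>j. j \<in> {1..k} \<Longrightarrow> card {i. i \<in> {1..n} \<and> c i = j} = t"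
    and r: "0 < r" "r \<le> k" and p: "p \<ge> 1" and n: "n \<ge> 1"
    and E: "E = {e. e \<subseteq> {1..n} \<and> card e = r \<and> inj_on c e}"
    and neg: "lambda_min r n E unit_weight p < 0"
  shows "lambda_max r n E unit_weight p / lambda_min r n E unit_weight p
           \<le> lambda_max r k (complete_rgraph r k) unit_weight p
               / lambda_min r k (complete_rgraph r k) unit_weight p"
proof -
  have p0: "p > 0" and k: "k \<ge> 1" using p r by linarith+
  let ?K = "complete_rgraph r k"
  let ?V = "\<lambda>j. {i. i \<in> {1..n} \<and> c i = j}"
  define s where "s = real t powr (1 - 1 / p)"
  have t: "real t > 0" using \<open>t \<ge> 1\<close> by simp
  have s: "s > 0" using t by (simp add: s_def)
  have E': "is_rgraph r n E" by (auto simp: E is_rgraph_def)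
  have LK: "lambda_max r k ?K unit_weight p > 0" and mK: "lambda_min r k ?K unit_weight p < 0"
    using lambda_signs[OF is_rgraph_complete complete_rgraph_nonempty[OF \<open>r \<le> k\<close>], of unit_weight p]
      p0 r by (simp_all add: unit_weight_def)
  have collapse: "poly_form r E unit_weight x
      = poly_form r ?K unit_weight (\<lambda>j. \<Sum>i\<in>?V j. x i)" for x
    unfolding poly_form_complete
    using sum_prod_transversals[OF _ _ c, where x = x and r = r]
    by (simp add: poly_form_def unit_weight_def E)
  have by_class: "(\<Sum>j=1..k. \<Sum>i\<in>?V j. h i) = (\<Sum>i=1..n. h i)" for h :: "nat \<Rightarrow> real"
    by (rule sum.group) (use c in auto)
  have max: "lambda_max r n E unit_weight p \<ge> s ^ r * lambda_max r k ?K unit_weight p"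
  proof -
    obtain y where y: "pnorm k p y = 1" "lambda_max r k ?K unit_weight p = poly_form r ?K unit_weight y"
      using lambda_max_attained[OF is_rgraph_complete k p0] by metis
    \<comment> \<open>Spread \<open>y\<close> evenly over the classes, scaled so that the \<open>p\<close>-norm is preserved.\<close>
    define x where "x i = real t powr (- 1 / p) * y (c i)" for i
    have "(\<Sum>i=1..n. \<bar>x i\<bar> powr p) = (\<Sum>j=1..k. \<Sum>i\<in>?V j. \<bar>x i\<bar> powr p)"
      by (rule by_class[symmetric])
    also have "\<dots> = (\<Sum>j=1..k. \<Sum>i\<in>?V j. \<bar>y j\<bar> powr p / t)"
      using p0 t by (intro sum.cong refl)
        (auto simp: x_def abs_mult powr_mult powr_divide powr_powr powr_minus_divide)
    also have "\<dots> = (\<Sum>j=1..k. \<bar>y j\<bar> powr p)" using size t by simp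
    also have "\<dots> = 1" using y(1) p0 by (simp add: pnorm_eq_1_iff)
    finally have x: "pnorm n p x = 1" using p0 by (simp add: pnorm_eq_1_iff)
    have "poly_form r E unit_weight x = poly_form r ?K unit_weight (\<lambda>j. s * y j)"
      unfolding collapse
    proof (rule poly_form_cong[OF is_rgraph_complete])
      fix j assume j: "j \<in> {1..k}"
      have "(\<Sum>i\<in>?V j. x i) = t * (real t powr (- 1 / p) * y j)"
        using size[OF j] by (simp add: x_def)
      also have "real t * real t powr (- 1 / p) = s"
        using t by (simp add: s_def powr_mult_base)
      then have "t * (real t powr (- 1 / p) * y j) = s * y j" by (metis mult.assoc)
      finally show "(\<Sum>i\<in>?V j. x i) = s * y j" .
    qed
    also have "\<dots> = s ^ r * lambda_max r k ?K unit_weight p"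
      by (simp add: poly_form_scale[OF is_rgraph_complete] y(2))
    finally show ?thesis using lambda_max_attained[OF E' n p0] x by metis
  qed
  have min: "lambda_min r n E unit_weight p \<ge> s ^ r * lambda_min r k ?K unit_weight p"
  proof -
    obtain x where x: "pnorm n p x = 1" "lambda_min r n E unit_weight p = poly_form r E unit_weight x"
      using lambda_min_attained[OF E' n p0] by metis
    define y where "y j = (\<Sum>i\<in>?V j. x i)" for j
    have per_class: "\<bar>y j\<bar> powr p \<le> s powr p * (\<Sum>i\<in>?V j. \<bar>x i\<bar> powr p)" if j: "j \<in> {1..k}" for j
    proof -
      define b where "b = (\<Sum>i\<in>?V j. \<bar>x i\<bar> powr p)"
      have b: "b \<ge> 0" by (simp add: b_def sum_nonneg)
      have "?V j \<noteq> {}" using size[OF j] \<open>t \<ge> 1\<close> by (metis card.empty not_one_le_zero)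
      have "\<bar>y j\<bar> \<le> (\<Sum>i\<in>?V j. \<bar>x i\<bar>)" unfolding y_def by (rule sum_abs)
      also have "\<dots> = (\<Sum>i\<in>?V j. (\<bar>x i\<bar> powr p) powr (1 / p))" using p0 by (simp add: powr_powr)
      also have "\<dots> \<le> t * (b / t) powr (1 / p)"
        using sum_powr_le_mean_powr[of "?V j" "\<lambda>i. \<bar>x i\<bar> powr p" "1 / p"] size[OF j] p
          \<open>?V j \<noteq> {}\<close> by (simp add: b_def)
      also have "\<dots> = s * b powr (1 / p)"
        using t b by (simp add: s_def powr_divide powr_diff)
      finally have "\<bar>y j\<bar> powr p \<le> (s * b powr (1 / p)) powr p"
        using p0 by (intro powr_mono2) auto
      also have "\<dots> = s powr p * b" using s b p0 by (simp add: powr_mult powr_powr)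
      finally show ?thesis by (simp add: b_def)
    qed
    have "(\<Sum>j=1..k. \<bar>y j\<bar> powr p) \<le> (\<Sum>j=1..k. s powr p * (\<Sum>i\<in>?V j. \<bar>x i\<bar> powr p))"
      by (rule sum_mono) (use per_class in auto)
    also have "\<dots> = s powr p" 
      unfolding sum_distrib_left[symmetric] by_class using x(1) p0 by (simp add: pnorm_eq_1_iff)
    finally have "pnorm k p y ^ r \<le> (s powr p) powr (real r / p)"
      using p0 r by (subst pnorm_power) (auto intro!: powr_mono2 sum_nonneg)
    also have "\<dots> = s ^ r" using s p0 by (simp add: powr_powr powr_realpow)
    finally have "lambda_min r k ?K unit_weight p * s ^ r
        \<le> lambda_min r k ?K unit_weight p * pnorm k p y ^ r"
      using mK by (simp add: mult_left_mono_neg)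
    also have "\<dots> \<le> poly_form r ?K unit_weight y"
      by (rule poly_form_bounds(2)[OF is_rgraph_complete k p0 \<open>0 < r\<close>])
    also have "\<dots> = lambda_min r n E unit_weight p" unfolding x(2) collapse y_def ..
    finally show ?thesis by (simp add: mult.commute)
  qed
  have "lambda_max r n E unit_weight p * lambda_min r k ?K unit_weight p
      \<le> s ^ r * lambda_max r k ?K unit_weight p * lambda_min r k ?K unit_weight p"
    using max mK by (simp add: mult_right_mono_neg)
  also have "\<dots> \<le> lambda_min r n E unit_weight p * lambda_max r k ?K unit_weight p"
    using mult_right_mono[OF min less_imp_le[OF LK]] by (simp add: mult_ac)
  finally show ?thesis using ratio_ge_iff[OF mK neg] by (simp add: mult_ac)
qed

section \<open>Ratio of the extrema\<close>

theorem theorem1: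
  fixes r k :: nat and p :: real
  assumes "r \<ge> 2" and "even r" and "k \<ge> r" and "p \<ge> real r"
  shows "(\<forall>(n::nat) (E::nat set set) (w::nat set \<Rightarrow> real).
            is_rgraph r n E \<and> is_partite k n E \<and> (\<exists>e\<in>E. w e \<noteq> 0) \<longrightarrow>
            lambda_max r n E w p / lambda_min r n E w p
              \<ge> lambda_max r k (complete_rgraph r k) unit_weight p
                  / lambda_min r k (complete_rgraph r k) unit_weight p)
       \<and> (\<forall>(n::nat) (E::nat set set).
            is_complete_partite r k n E \<and> is_regular n E \<longrightarrow>
            lambda_max r n E unit_weight p / lambda_min r n E unit_weight p
              = lambda_max r k (complete_rgraph r k) unit_weight p
                  / lambda_min r k (complete_rgraph r k) unit_weight p)"
proof (intro conjI allI impI)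
  fix n :: nat and E :: "nat set set" and w :: "nat set \<Rightarrow> real"
  assume *: "is_rgraph r n E \<and> is_partite k n E \<and> (\<exists>e\<in>E. w e \<noteq> 0)"
  then obtain V e where V: "vertex_partition k n V" "\<forall>e\<in>E. \<forall>j\<in>{1..k}. card (e \<inter> V j) \<le> 1"
    and e: "e \<in> E" "w e \<noteq> 0" by (auto simp: is_partite_def)
  obtain c where c: "c ` {1..n} \<subseteq> {1..k}"
    "\<forall>e\<subseteq>{1..n}. (\<forall>j\<in>{1..k}. card (e \<inter> V j) \<le> 1) \<longleftrightarrow> inj_on c e"
    using vertex_partition_colouring[OF V(1)] by metis
  have "inj_on c e" if "e \<in> E" for e
    using c(2) V(2) that * by (auto simp: is_rgraph_def)
  then show "lambda_max r n E w p / lambda_min r n E w p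
      \<ge> lambda_max r k (complete_rgraph r k) unit_weight p
          / lambda_min r k (complete_rgraph r k) unit_weight p"
    using lambda_ratio_partite_ge[where w = w and e = e, OF _ c(1)] e * assms by auto
next
  fix n :: nat and E :: "nat set set"
  assume *: "is_complete_partite r k n E \<and> is_regular n E"
  then obtain V where V: "vertex_partition k n V" "\<forall>j\<in>{1..k}. V j \<noteq> {}"
    "E = {e. e \<subseteq> {1..n} \<and> card e = r \<and> (\<forall>j\<in>{1..k}. card (e \<inter> V j) \<le> 1)}"
    by (auto simp: is_complete_partite_def)
  obtain c where c: "c ` {1..n} \<subseteq> {1..k}"
    "\<forall>j\<in>{1..k}. V j = {i. i \<in> {1..n} \<and> c i = j}"
    "\<forall>e\<subseteq>{1..n}. (\<forall>j\<in>{1..k}. card (e \<inter> V j) \<le> 1) \<longleftrightarrow> inj_on c e"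
    by (rule vertex_partition_colouring[OF V(1)]) (rule that)
  have E: "E = {e. e \<subseteq> {1..n} \<and> card e = r \<and> inj_on c e}"
    unfolding V(3) using c(3) by blast
  have E': "is_rgraph r n E" by (auto simp: E is_rgraph_def)
  have r: "0 < r" "r \<le> k" "real r \<le> p" and p: "p \<ge> 1" using assms by auto
  have per_class: "{i. i \<in> {1..n} \<and> c i = j} \<noteq> {}" if "j \<in> {1..k}" for j
    using that V(2) c(2) by metis
  have "real (card E) > 0"
    unfolding E
  proof (subst card_transversals[of _ "{1..k}"])
    show "elem_sym r {1..k} (\<lambda>j. real (card {i. i \<in> {1..n} \<and> c i = j})) > 0"
    proof (rule elem_sym_pos)
      show "real (card {i. i \<in> {1..n} \<and> c i = j}) > 0" if "j \<in> {1..k}" for j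
        using per_class[OF that] by (simp add: card_gt_0_iff)
    qed (use r in auto)
  qed (use c in auto)
  then obtain e where e: "e \<in> E" by fastforce
  then have "e \<subseteq> {1..n}" "e \<noteq> {}" using E r by auto
  then have n: "n \<ge> 1" by auto
  have inj: "inj_on c e" if "e \<in> E" for e using that by (simp add: E)
  define t where "t = card {i. i \<in> {1..n} \<and> c i = 1}"
  have one: "1 \<in> {1..k}" using r by auto
  have t: "t \<ge> 1" using per_class[OF one] by (simp add: t_def Suc_le_eq card_gt_0_iff)
  have size: "card {i. i \<in> {1..n} \<and> c i = j} = t" if "j \<in> {1..k}" for j
    unfolding t_def
    by (rule regular_imp_equal_classes[of "{1..k}" r, OF _ _ _ c(1)])
       (use per_class that one assms * E in auto)
  show "lambda_max r n E unit_weight p / lambda_min r n E unit_weight p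
      = lambda_max r k (complete_rgraph r k) unit_weight p
          / lambda_min r k (complete_rgraph r k) unit_weight p"
  proof (rule antisym)
    show "lambda_max r k (complete_rgraph r k) unit_weight p
          / lambda_min r k (complete_rgraph r k) unit_weight p
        \<le> lambda_max r n E unit_weight p / lambda_min r n E unit_weight p"
      by (rule lambda_ratio_partite_ge[where w = unit_weight, OF E' c(1) inj e _ r]) (simp_all add: unit_weight_def)
    have neg: "lambda_min r n E unit_weight p < 0"
      using lambda_signs(2)[OF E' e, of unit_weight p] r p by (simp add: unit_weight_def)
    show "lambda_max r n E unit_weight p / lambda_min r n E unit_weight p
        \<le> lambda_max r k (complete_rgraph r k) unit_weight p
          / lambda_min r k (complete_rgraph r k) unit_weight p"
      by (rule lambda_ratio_complete_balanced_le[OF c(1) t size r(1,2) p n E neg])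
  qed
qed

end
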